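(* Let $n$ be a natural number, $Ks$ a set of keys and $G$ a set of messages such that every message of $G$ belongs to $\mathit{guard}\ n\ Ks$. If $\mathit{Nonce}\ n \in \mathit{analz}\ G$, then there exists a key $K \in Ks$ with $\mathit{Key}\ K \in \mathit{analz}\ G$.
   Context: Messages are elements of the free inductive datatype msg ::= Number nat | Nonce nat | Agent agent | Key key | Hash msg | ⟨msg, msg⟩ | Crypt key msg, where keys are natural numbers and agents are Server, Friend $i$ ($i\in\mathbb N$) or Spy. Constructors are injective with pairwise disjoint images. There is a function $\mathit{invKey}$ on keys giving the inverse of a key (for a public key $\mathit{pubK}\ A$ it is the private key $\mathit{priK}\ A$ and vice versa; a symmetric key is its own inverse). $\mathit{parts}\ H$ is the least set containing $H$ and closed under: $\langle X,Y\rangle \in \mathit{parts}\ H \Rightarrow X,Y\in \mathit{parts}\ H$; $\mathit{Crypt}\ K\ X\in \mathit{parts}\ H\Rightarrow X\in\mathit{parts}\ H$. $\mathit{analz}\ H$ is the least set containing $H$ and closed under: $\langle X,Y\rangle\in\mathit{analz}\ H\Rightarrow X,Y\in\mathit{analz}\ H$; if $\mathit{Crypt}\ K\ X\in\mathit{analz}\ H$ and $\mathit{Key}(\mathit{invKey}\ K)\in\mathit{analz}\ H$ then $X\in\mathit{analz}\ H$. For a nonce/key index $n$ and a set of keys $Ks$, $\mathit{guard}\ n\ Ks$ is the least set of messages such that: (i) if $\mathit{Nonce}\ n\notin\mathit{parts}\{X\}$ then $X\in\mathit{guard}\ n\ Ks$; (ii) if $\mathit{invKey}\ K\in Ks$ then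 $\mathit{Crypt}\ K\ X\in\mathit{guard}\ n\ Ks$ for every $X$; (iii) if $X\in\mathit{guard}\ n\ Ks$ then $\mathit{Crypt}\ K\ X\in\mathit{guard}\ n\ Ks$ for every $K$; (iv) if $X,Y\in\mathit{guard}\ n\ Ks$ then $\langle X,Y\rangle\in\mathit{guard}\ n\ Ks$. *)

theory Defs
  imports Main
begin

type_synonym key = nat

datatype agent = Server | Friend nat | Spy

datatype msg =
    Number nat
  | Nonce nat
  | Agent agent
  | Key key
  | Hash msg
  | MPair msg msg
  | Crypt key msg

text \<open>The key inversion function is not a fixed function on the natural numbers, so it is
  a parameter subject to the following laws. The public keys, the private keys and the set of
  symmetric keys are parameters as well; they need not exhaust all keys.\<close>

locale key_inversion =
  fixes invKey :: "key \<Rightarrow> key"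
    and pubK priK :: "agent \<Rightarrow> key"
    and symKeys :: "key set"
  assumes invKey_invKey: "invKey (invKey K) = K"
    and invKey_pubK: "invKey (pubK A) = priK A"
    and invKey_priK: "invKey (priK A) = pubK A"
    and invKey_symKeys: "K \<in> symKeys \<Longrightarrow> invKey K = K"

inductive_set parts :: "msg set \<Rightarrow> msg set" for H :: "msg set" where
  Inj: "X \<in> H \<Longrightarrow> X \<in> parts H"
| Fst: "MPair X Y \<in> parts H \<Longrightarrow> X \<in> parts H"
| Snd: "MPair X Y \<in> parts H \<Longrightarrow> Y \<in> parts H"
| Body: "Crypt K X \<in> parts H \<Longrightarrow> X \<in> parts H"

inductive_set analz :: "(key \<Rightarrow> key) \<Rightarrow> msg set \<Rightarrow> msg set"
  for invKey :: "key \<Rightarrow> key" and H :: "msg set" where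
  Inj: "X \<in> H \<Longrightarrow> X \<in> analz invKey H"
| Fst: "MPair X Y \<in> analz invKey H \<Longrightarrow> X \<in> analz invKey H"
| Snd: "MPair X Y \<in> analz invKey H \<Longrightarrow> Y \<in> analz invKey H"
| Decrypt: "Crypt K X \<in> analz invKey H \<Longrightarrow> Key (invKey K) \<in> analz invKey H
    \<Longrightarrow> X \<in> analz invKey H"

inductive_set guard :: "(key \<Rightarrow> key) \<Rightarrow> nat \<Rightarrow> key set \<Rightarrow> msg set"
  for invKey :: "key \<Rightarrow> key" and n :: nat and Ks :: "key set" where
  No_Nonce: "Nonce n \<notin> parts {X} \<Longrightarrow> X \<in> guard invKey n Ks"
| Guard_Nonce: "invKey K \<in> Ks \<Longrightarrow> Crypt K X \<in> guard invKey n Ks"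
| Crypt: "X \<in> guard invKey n Ks \<Longrightarrow> Crypt K X \<in> guard invKey n Ks"
| Pair: "X \<in> guard invKey n Ks \<Longrightarrow> Y \<in> guard invKey n Ks
    \<Longrightarrow> MPair X Y \<in> guard invKey n Ks"

end

theory Submission
  imports Defs
begin

text \<open>If no key of \<open>Ks\<close> can be derived from \<open>G\<close>, then \<open>guard\<close> is preserved by every
  rule of \<open>analz\<close>, since a ciphertext that is guarded by its own key is never opened. As
  \<open>Nonce n\<close> is not guarded, it cannot be derived.\<close>

lemma parts_trans: "Y \<in> parts {X} \<Longrightarrow> X \<in> parts H \<Longrightarrow> Y \<in> parts H"
  by (induction rule: parts.induct) (auto intro: parts.intros)

lemma Nonce_notin_guard: "Nonce n \<notin> guard invKey n Ks"
  by (auto elim: guard.cases intro: parts.Inj)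

text \<open>A pair enters \<open>guard\<close> by \<open>Pair\<close> or by \<open>No_Nonce\<close>;
  in the latter case its components avoid \<open>Nonce n\<close> too, as their parts are parts of
  the pair.\<close>

lemma guard_MPairD:
  assumes "MPair X Y \<in> guard invKey n Ks"
  shows "X \<in> guard invKey n Ks" and "Y \<in> guard invKey n Ks"
proof -
  have "X \<in> parts {MPair X Y}" "Y \<in> parts {MPair X Y}"
    by (blast intro: parts.intros)+
  with assms show "X \<in> guard invKey n Ks" "Y \<in> guard invKey n Ks"
    by (auto elim!: guard.cases[of "MPair X Y"] intro: guard.No_Nonce dest: parts_trans)
qed

text \<open>The side condition excludes \<open>Guard_Nonce\<close>, the only rule that accepts an
  arbitrary body.\<close>

lemma guard_CryptD:
  assumes "Crypt K X \<in> guard invKey n Ks" and "invKey K \<notin> Ks"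
  shows "X \<in> guard invKey n Ks"
proof -
  have "X \<in> parts {Crypt K X}"
    by (blast intro: parts.intros)
  with assms show ?thesis
    by (auto elim!: guard.cases[of "Crypt K X"] intro: guard.No_Nonce dest: parts_trans)
qed

lemma analz_subset_guard:
  assumes "G \<subseteq> guard invKey n Ks" and "\<And>K. K \<in> Ks \<Longrightarrow> Key K \<notin> analz invKey G"
  shows "analz invKey G \<subseteq> guard invKey n Ks"
proof
  fix X assume "X \<in> analz invKey G"
  then show "X \<in> guard invKey n Ks"
    \<comment> \<open>In the \<open>Decrypt\<close> case \<open>Key (invKey K)\<close> is derivable,
      so \<open>invKey K\<close> lies outside \<open>Ks\<close>, as \<open>guard_CryptD\<close>
      requires.\<close>
    by induction (use assms in \<open>blast dest: guard_MPairD guard_CryptD\<close>)+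
qed

theorem mainTheorem1:
  fixes invKey :: "key \<Rightarrow> key"
    and pubK priK :: "agent \<Rightarrow> key"
    and symKeys :: "key set"
    and n :: nat
    and Ks :: "key set"
    and G :: "msg set"
  assumes "key_inversion invKey pubK priK symKeys"
    and "\<forall>X\<in>G. X \<in> guard invKey n Ks"
    and "Nonce n \<in> analz invKey G"
  shows "\<exists>K\<in>Ks. Key K \<in> analz invKey G"
  using analz_subset_guard[of G invKey n Ks] Nonce_notin_guard assms(2,3) by blast

end
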